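(* Let $\mathcal{G}$ be a locally compact group and let $\mathcal{X}$ be a $\mathcal{G}$-space. Under the mapping $(m,M)\mapsto m\cdot M$ from $LUC(\mathcal{G})^*\times LUC(\mathcal{X},\mathcal{G})^*$ to $LUC(\mathcal{X},\mathcal{G})^*$ defined by $\langle m\cdot M,F\rangle=\langle m,MF\rangle$ for $F\in LUC(\mathcal{X},\mathcal{G})$, the space $LUC(\mathcal{X},\mathcal{G})^*$ becomes a Banach left $LUC(\mathcal{G})^*$-module (where $LUC(\mathcal{G})^*$ carries the product $\odot$), with $\|m\cdot M\|\le\|m\|\,\|M\|$ and $\delta_e\cdot M=M$ for all $m\in LUC(\mathcal{G})^*$ and $M\in LUC(\mathcal{X},\mathcal{G})^*$.
   Context: A (left) $\mathcal{G}$-space is a locally compact Hausdorff space $\mathcal{X}$ with a continuous map $\mathcal{G}\times\mathcal{X}\to\mathcal{X}$, $(s,x)\mapsto s\cdot x$, such that $(st)\cdot x=s\cdot(t\cdot x)$ and $e\cdot x=x$ for all $s,t\in\mathcal{G}$, $x\in\mathcal{X}$, where $e$ is the identity of $\mathcal{G}$. $C_b(\mathcal{X})$ is the space of bounded continuous complex-valued functions on $\mathcal{X}$ with the supremum norm. For $F\in C_b(\mathcal{X})$ and $s\in\mathcal{G}$ put $(l_sF)(x)=F(s\cdot x)$, and let $$LUC(\mathcal{X},\mathcal{G})=\{F\in C_b(\mathcal{X}): s\mapsto l_sF \text{ is continuous from } \mathcal{G} \text{ into } (C_b(\mathcal{X}),\|\cdot\|_\infty)\},$$ a closed subspace of $C_b(\mathcal{X})$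 invariant under all $l_s$. $LUC(\mathcal{G})=LUC(\mathcal{G},\mathcal{G})$, with $\mathcal{G}$ acting on itself by left translation; write ${}_sf(t)=f(st)$. $LUC(\mathcal{G})^*$ is a Banach algebra with the product $\langle m\odot n,f\rangle=\langle m,n\diamond f\rangle$, where $(n\diamond f)(s)=\langle n,{}_sf\rangle$ for $f\in LUC(\mathcal{G})$, $s\in\mathcal{G}$. For $M\in LUC(\mathcal{X},\mathcal{G})^*$ and $F\in LUC(\mathcal{X},\mathcal{G})$, the function $MF\in LUC(\mathcal{G})$ is given by $(MF)(s)=\langle M,l_sF\rangle$. $\delta_e\in LUC(\mathcal{G})^*$ is evaluation at $e$. *)

theory Defs
  imports "HOL-Analysis.Analysis" "HOL-Library.Function_Algebras"
begin

section \<open>Banach spaces, Banach algebras and Banach modules over the complex numbers\<close>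

text \<open>
  The underlying vector space is a subspace \<open>V\<close> of a complex vector space living on a whole type,
  and the norm is only constrained on \<open>V\<close>.
\<close>

locale complex_banach_space = vector_space scale
  for scale :: "complex \<Rightarrow> 'a::ab_group_add \<Rightarrow> 'a" +
  fixes V :: "'a set" and nrm :: "'a \<Rightarrow> real"
  assumes subspace_V: "subspace V"
    and nrm_nonneg: "x \<in> V \<Longrightarrow> 0 \<le> nrm x"
    and nrm_eq_0: "x \<in> V \<Longrightarrow> nrm x = 0 \<longleftrightarrow> x = 0"
    and nrm_scale: "x \<in> V \<Longrightarrow> nrm (scale c x) = cmod c * nrm x"
    and nrm_triangle: "x \<in> V \<Longrightarrow> y \<in> V \<Longrightarrow> nrm (x + y) \<le> nrm x + nrm y"
    and complete:
      "(\<And>n. u n \<in> V) \<Longrightarrow>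
       (\<And>e. e > 0 \<Longrightarrow> \<exists>N. \<forall>i\<ge>N. \<forall>j\<ge>N. nrm (u i - u j) < e) \<Longrightarrow>
       \<exists>l\<in>V. (\<lambda>n::nat. nrm (u n - l)) \<longlonglongrightarrow> 0"

text \<open>No unit is required.\<close>

locale complex_banach_algebra = complex_banach_space scale A nrm
  for scale :: "complex \<Rightarrow> 'a::ab_group_add \<Rightarrow> 'a" and A :: "'a set" and nrm :: "'a \<Rightarrow> real" +
  fixes mult :: "'a \<Rightarrow> 'a \<Rightarrow> 'a"
  assumes mult_closed: "a \<in> A \<Longrightarrow> b \<in> A \<Longrightarrow> mult a b \<in> A"
    and mult_assoc: "a \<in> A \<Longrightarrow> b \<in> A \<Longrightarrow> c \<in> A \<Longrightarrow> mult (mult a b) c = mult a (mult b c)"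
    and mult_add_left: "a \<in> A \<Longrightarrow> b \<in> A \<Longrightarrow> c \<in> A \<Longrightarrow> mult (a + b) c = mult a c + mult b c"
    and mult_add_right: "a \<in> A \<Longrightarrow> b \<in> A \<Longrightarrow> c \<in> A \<Longrightarrow> mult a (b + c) = mult a b + mult a c"
    and mult_scale_left: "a \<in> A \<Longrightarrow> b \<in> A \<Longrightarrow> mult (scale k a) b = scale k (mult a b)"
    and mult_scale_right: "a \<in> A \<Longrightarrow> b \<in> A \<Longrightarrow> mult a (scale k b) = scale k (mult a b)"
    and nrm_mult: "a \<in> A \<Longrightarrow> b \<in> A \<Longrightarrow> nrm (mult a b) \<le> nrm a * nrm b"

locale banach_left_module =
  A: complex_banach_algebra scaleA A nrmA mult +
  E: complex_banach_space scaleE E nrmE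
  for scaleA :: "complex \<Rightarrow> 'a::ab_group_add \<Rightarrow> 'a" and A :: "'a set" and nrmA :: "'a \<Rightarrow> real"
    and mult :: "'a \<Rightarrow> 'a \<Rightarrow> 'a"
    and scaleE :: "complex \<Rightarrow> 'e::ab_group_add \<Rightarrow> 'e" and E :: "'e set" and nrmE :: "'e \<Rightarrow> real" +
  fixes smul :: "'a \<Rightarrow> 'e \<Rightarrow> 'e"
  assumes smul_closed: "a \<in> A \<Longrightarrow> x \<in> E \<Longrightarrow> smul a x \<in> E"
    and smul_assoc: "a \<in> A \<Longrightarrow> b \<in> A \<Longrightarrow> x \<in> E \<Longrightarrow> smul (mult a b) x = smul a (smul b x)"
    and smul_add_left: "a \<in> A \<Longrightarrow> b \<in> A \<Longrightarrow> x \<in> E \<Longrightarrow> smul (a + b) x = smul a x + smul b x"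
    and smul_add_right: "a \<in> A \<Longrightarrow> x \<in> E \<Longrightarrow> y \<in> E \<Longrightarrow> smul a (x + y) = smul a x + smul a y"
    and smul_scale_left: "a \<in> A \<Longrightarrow> x \<in> E \<Longrightarrow> smul (scaleA k a) x = scaleE k (smul a x)"
    and smul_scale_right: "a \<in> A \<Longrightarrow> x \<in> E \<Longrightarrow> smul a (scaleE k x) = scaleE k (smul a x)"
    and nrm_smul: "\<exists>K. \<forall>a\<in>A. \<forall>x\<in>E. nrmE (smul a x) \<le> K * nrmA a * nrmE x"


section \<open>Continuous duals of spaces of bounded continuous functions\<close>

text \<open>
  The type of complex-valued bounded continuous functions with its supremum norm is
  \<open>'x \<Rightarrow>\<^sub>C complex\<close>; the library equips it only with real scalars.
\<close>

definition cscale :: "complex \<Rightarrow> ('x::topological_space \<Rightarrow>\<^sub>C complex) \<Rightarrow> ('x \<Rightarrow>\<^sub>C complex)"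
  where "cscale c F = Bcontfun (\<lambda>x. c * F x)"

text \<open>
  An element of the dual of a complex subspace \<open>L\<close> is represented by the unique function on all of
  \<open>'x \<Rightarrow>\<^sub>C complex\<close> extending it by \<open>0\<close> outside \<open>L\<close>. The vector space operations on functionals
  are then the pointwise ones.
\<close>

definition dual ::
    "('x::topological_space \<Rightarrow>\<^sub>C complex) set \<Rightarrow> (('x \<Rightarrow>\<^sub>C complex) \<Rightarrow> complex) set"
  where "dual L = {m.
    (\<forall>F\<in>L. \<forall>H\<in>L. m (F + H) = m F + m H) \<and>
    (\<forall>c. \<forall>F\<in>L. m (cscale c F) = c * m F) \<and>
    (\<exists>K. \<forall>F\<in>L. cmod (m F) \<le> K * norm F) \<and>
    (\<forall>F. F \<notin> L \<longrightarrow> m F = 0)}"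

definition dual_norm ::
    "('x::topological_space \<Rightarrow>\<^sub>C complex) set \<Rightarrow> (('x \<Rightarrow>\<^sub>C complex) \<Rightarrow> complex) \<Rightarrow> real"
  where "dual_norm L m = (SUP F\<in>{F\<in>L. norm F \<le> 1}. cmod (m F))"

definition dual_scale :: "complex \<Rightarrow> ('f \<Rightarrow> complex) \<Rightarrow> ('f \<Rightarrow> complex)"
  where "dual_scale c m = (\<lambda>F. c * m F)"


section \<open>G-spaces\<close>

text \<open>
  The library's class of (not necessarily commutative) topological groups is written additively:
  the product \<open>st\<close> is \<open>s + t\<close> and the identity \<open>e\<close> is \<open>0\<close>.
\<close>

definition G_space :: "('g::topological_group_add \<Rightarrow> 'x::t2_space \<Rightarrow> 'x) \<Rightarrow> bool"
  where "G_space act \<longleftrightarrow>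
    locally_compact_space (euclidean :: 'x topology) \<and>
    continuous_on UNIV (\<lambda>(s, x). act s x) \<and>
    (\<forall>s t x. act (s + t) x = act s (act t x)) \<and>
    (\<forall>x. act 0 x = x)"

definition ltrans ::
    "('g \<Rightarrow> 'x::topological_space \<Rightarrow> 'x) \<Rightarrow> 'g \<Rightarrow> ('x \<Rightarrow>\<^sub>C complex) \<Rightarrow> ('x \<Rightarrow>\<^sub>C complex)"
  where "ltrans act s F = Bcontfun (\<lambda>x. F (act s x))"

definition LUC ::
    "('g::topological_space \<Rightarrow> 'x::topological_space \<Rightarrow> 'x) \<Rightarrow> ('x \<Rightarrow>\<^sub>C complex) set"
  where "LUC act = {F. continuous_on UNIV (\<lambda>s. ltrans act s F)}"

abbreviation LUC_group :: "('g::topological_group_add \<Rightarrow>\<^sub>C complex) set"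
  where "LUC_group \<equiv> LUC ((+) :: 'g \<Rightarrow> 'g \<Rightarrow> 'g)"

text \<open>The function \<open>MF\<close>, that is, \<open>s \<mapsto> \<langle>M, l\<^sub>s F\<rangle>\<close>.\<close>

definition orbit_fun ::
    "('g::topological_space \<Rightarrow> 'x::topological_space \<Rightarrow> 'x) \<Rightarrow> (('x \<Rightarrow>\<^sub>C complex) \<Rightarrow> complex) \<Rightarrow>
     ('x \<Rightarrow>\<^sub>C complex) \<Rightarrow> ('g \<Rightarrow>\<^sub>C complex)"
  where "orbit_fun act M F = Bcontfun (\<lambda>s. M (ltrans act s F))"

definition LUC_smul ::
    "('g::topological_group_add \<Rightarrow> 'x::topological_space \<Rightarrow> 'x) \<Rightarrow> (('g \<Rightarrow>\<^sub>C complex) \<Rightarrow> complex) \<Rightarrow>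
     (('x \<Rightarrow>\<^sub>C complex) \<Rightarrow> complex) \<Rightarrow> (('x \<Rightarrow>\<^sub>C complex) \<Rightarrow> complex)"
  where "LUC_smul act m M = (\<lambda>F. if F \<in> LUC act then m (orbit_fun act M F) else 0)"

text \<open>
  The function \<open>\<^sub>sf\<close> is \<open>l\<^sub>s f\<close> for the left translation action, so
  \<open>n \<diamond> f\<close> is the function \<open>s \<mapsto> \<langle>n, ltrans (+) s f\<rangle>\<close>.
\<close>

definition diamond ::
    "(('g::topological_group_add \<Rightarrow>\<^sub>C complex) \<Rightarrow> complex) \<Rightarrow> ('g \<Rightarrow>\<^sub>C complex) \<Rightarrow> ('g \<Rightarrow>\<^sub>C complex)"
  where "diamond n f = Bcontfun (\<lambda>s. n (ltrans (+) s f))"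

definition LUC_mult ::
    "(('g::topological_group_add \<Rightarrow>\<^sub>C complex) \<Rightarrow> complex) \<Rightarrow> (('g \<Rightarrow>\<^sub>C complex) \<Rightarrow> complex) \<Rightarrow>
     (('g \<Rightarrow>\<^sub>C complex) \<Rightarrow> complex)"
  where "LUC_mult m n = (\<lambda>f. if f \<in> LUC_group then m (diamond n f) else 0)"

definition delta_e :: "('g::topological_group_add \<Rightarrow>\<^sub>C complex) \<Rightarrow> complex"
  where "delta_e = (\<lambda>f. if f \<in> LUC_group then f 0 else 0)"


section \<open>Well-definedness of the constructions\<close>

lemma apply_cscale [simp]: "apply_bcontfun (cscale c F) x = c * F x"
proof -
  have "(\<lambda>x. c * F x) \<in> bcontfun"
    unfolding bcontfun_def
    using bounded_linear_image[OF bounded_apply_bcontfun[of F] bounded_linear_mult_right[of c]]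
    by (auto intro!: continuous_intros simp: image_image)
  then show ?thesis by (simp add: cscale_def Bcontfun_inverse)
qed

lemma G_space_translation:
  assumes "locally_compact_space (euclidean :: 'g::{topological_group_add,t2_space} topology)"
  shows "G_space ((+) :: 'g \<Rightarrow> 'g \<Rightarrow> 'g)"
  unfolding G_space_def using assms
  by (auto simp: add.assoc split_beta intro!: continuous_intros)

lemma continuous_on_act:
  assumes "G_space act"
  shows "continuous_on UNIV (act s)"
proof -
  have "continuous_on UNIV ((\<lambda>(s, x). act s x) \<circ> (\<lambda>x. (s, x)))"
    by (rule continuous_on_compose)
      (use assms in \<open>auto simp: G_space_def intro!: continuous_intros intro: continuous_on_subset\<close>)
  then show ?thesis by (simp add: o_def)
qed

lemma apply_ltrans:
  assumes "G_space act"
  shows "apply_bcontfun (ltrans act s F) x = F (act s x)"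
proof -
  have "(\<lambda>x. F (act s x)) \<in> bcontfun"
    unfolding bcontfun_def
    using continuous_on_compose[OF continuous_on_act[OF assms], of s "apply_bcontfun F"]
    by (auto simp: o_def intro: bounded_subset[OF bounded_apply_bcontfun[of F]])
  then show ?thesis by (simp add: ltrans_def Bcontfun_inverse)
qed

lemma ltrans_ltrans:
  assumes "G_space act"
  shows "ltrans act s (ltrans act t F) = ltrans act (t + s) F"
  using assms by (intro bcontfun_eqI) (simp add: apply_ltrans G_space_def)

lemma norm_ltrans_le:
  assumes "G_space act"
  shows "norm (ltrans act s F) \<le> norm F"
  using assms by (intro norm_bound) (simp add: apply_ltrans norm_bounded)

lemma ltrans_in_LUC:
  assumes "G_space act" and "F \<in> LUC act"
  shows "ltrans act s F \<in> LUC act"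
proof -
  have "continuous_on UNIV ((\<lambda>t. ltrans act t F) \<circ> (\<lambda>t. s + t))"
    by (rule continuous_on_compose)
      (use assms in \<open>auto simp: LUC_def intro!: continuous_intros intro: continuous_on_subset\<close>)
  then show ?thesis by (simp add: LUC_def ltrans_ltrans[OF assms(1)] o_def)
qed

lemma dual_bound:
  assumes "M \<in> dual (LUC act)"
  obtains K where "K \<ge> 0"
    and "\<And>F. F \<in> LUC act \<Longrightarrow> cmod (M F) \<le> K * norm F"
proof -
  obtain K where K: "\<And>F. F \<in> LUC act \<Longrightarrow> cmod (M F) \<le> K * norm F"
    using assms unfolding dual_def by blast
  show thesis
  proof
    show "cmod (M F) \<le> \<bar>K\<bar> * norm F" if "F \<in> LUC act" for F
      using K[OF that] by (rule order_trans) (simp add: mult_right_mono)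
  qed simp
qed

lemma diff_in_LUC:
  assumes "G_space act" and "F \<in> LUC act" and "H \<in> LUC act"
  shows "F - H \<in> LUC act"
proof -
  have "ltrans act s (F - H) = ltrans act s F - ltrans act s H" for s
    using assms(1) by (intro bcontfun_eqI) (simp add: apply_ltrans)
  then show ?thesis using assms by (auto simp: LUC_def intro!: continuous_intros)
qed

lemma dual_diff:
  assumes "G_space act" and "M \<in> dual (LUC act)" and "F \<in> LUC act" and "H \<in> LUC act"
  shows "M (F - H) = M F - M H"
proof -
  have "M ((F - H) + H) = M (F - H) + M H"
    using assms(2,4) diff_in_LUC[OF assms(1,3,4)] unfolding dual_def by blast
  then show ?thesis by simp
qed

lemma orbit_fun_in_bcontfun:
  assumes "G_space act" and "M \<in> dual (LUC act)" and "F \<in> LUC act"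
  shows "(\<lambda>s. M (ltrans act s F)) \<in> bcontfun"
proof -
  obtain K where "K \<ge> 0" and K: "\<And>F. F \<in> LUC act \<Longrightarrow> cmod (M F) \<le> K * norm F"
    using dual_bound[OF assms(2)] by blast
  have "cmod (M (ltrans act s F)) \<le> K * norm F" for s
    using K[OF ltrans_in_LUC[OF assms(1,3)]] norm_ltrans_le[OF assms(1)] \<open>K \<ge> 0\<close>
    by (meson mult_left_mono order_trans)
  then have "bounded (range (\<lambda>s. M (ltrans act s F)))"
    by (auto simp: bounded_iff)
  moreover have "((\<lambda>s. M (ltrans act s F)) \<longlongrightarrow> M (ltrans act t F)) (at t)" for t
  proof (rule Lim_transform_bound[THEN LIM_zero_cancel])
    have "((\<lambda>s. ltrans act s F) \<longlongrightarrow> ltrans act t F) (at t)"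
      using assms(3) by (simp add: LUC_def continuous_on_def)
    from tendsto_mult_right_zero[OF tendsto_norm_zero[OF LIM_zero[OF this]], of K]
    show "((\<lambda>s. K * norm (ltrans act s F - ltrans act t F)) \<longlongrightarrow> 0) (at t)" .
    show "\<forall>\<^sub>F s in at t. cmod (M (ltrans act s F) - M (ltrans act t F))
            \<le> norm (K * norm (ltrans act s F - ltrans act t F))"
      using K[OF diff_in_LUC[OF assms(1) ltrans_in_LUC[OF assms(1,3)] ltrans_in_LUC[OF assms(1,3)]]]
        dual_diff[OF assms(1,2) ltrans_in_LUC[OF assms(1,3)] ltrans_in_LUC[OF assms(1,3)]] \<open>K \<ge> 0\<close>
      by (simp add: abs_mult)
  qed
  ultimately show ?thesis by (simp add: bcontfun_def continuous_on_def)
qed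

lemma apply_orbit_fun:
  assumes "G_space act" and "M \<in> dual (LUC act)" and "F \<in> LUC act"
  shows "apply_bcontfun (orbit_fun act M F) s = M (ltrans act s F)"
  using orbit_fun_in_bcontfun[OF assms] by (simp add: orbit_fun_def Bcontfun_inverse)

lemma orbit_fun_in_LUC_group:
  fixes act :: "'g::{topological_group_add,t2_space} \<Rightarrow> 'x::t2_space \<Rightarrow> 'x"
  assumes "locally_compact_space (euclidean :: 'g topology)"
    and "G_space act" and "M \<in> dual (LUC act)" and "F \<in> LUC act"
  shows "orbit_fun act M F \<in> LUC_group"
proof -
  obtain K where "K \<ge> 0" and K: "\<And>F. F \<in> LUC act \<Longrightarrow> cmod (M F) \<le> K * norm F"
    using dual_bound[OF assms(3)] by blast
  note apply_l = apply_ltrans[OF G_space_translation[OF assms(1)]]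
  have L: "ltrans act s F \<in> LUC act" for s by (rule ltrans_in_LUC[OF assms(2,4)])
  have bound: "norm (ltrans (+) s (orbit_fun act M F) - ltrans (+) t (orbit_fun act M F))
      \<le> K * norm (ltrans act s F - ltrans act t F)" (is "norm ?D \<le> ?R") for s t
  proof (rule norm_bound)
    fix r
    have "apply_bcontfun ?D r = M (ltrans act (s + r) F) - M (ltrans act (t + r) F)"
      by (simp add: apply_l apply_orbit_fun[OF assms(2-4)])
    also have "\<dots> = M (ltrans act (s + r) F - ltrans act (t + r) F)"
      using dual_diff[OF assms(2,3) L L] by simp
    also have "ltrans act (s + r) F - ltrans act (t + r) F =
        ltrans act r (ltrans act s F - ltrans act t F)"
      unfolding ltrans_ltrans[OF assms(2), symmetric]
      by (intro bcontfun_eqI) (simp add: apply_ltrans[OF assms(2)])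
    finally have "cmod (apply_bcontfun ?D r)
        \<le> K * norm (ltrans act r (ltrans act s F - ltrans act t F))"
      using K[OF ltrans_in_LUC[OF assms(2) diff_in_LUC[OF assms(2) L L]]] by simp
    also have "\<dots> \<le> ?R"
      using \<open>K \<ge> 0\<close> by (intro mult_left_mono norm_ltrans_le[OF assms(2)])
    finally show "cmod (apply_bcontfun ?D r) \<le> ?R" .
  qed
  have "((\<lambda>s. ltrans (+) s (orbit_fun act M F)) \<longlongrightarrow> ltrans (+) t (orbit_fun act M F)) (at t)" for t
  proof (rule Lim_transform_bound[THEN LIM_zero_cancel])
    have "((\<lambda>s. ltrans act s F) \<longlongrightarrow> ltrans act t F) (at t)"
      using assms(4) by (simp add: LUC_def continuous_on_def)
    from tendsto_mult_right_zero[OF tendsto_norm_zero[OF LIM_zero[OF this]], of K]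
    show "((\<lambda>s. K * norm (ltrans act s F - ltrans act t F)) \<longlongrightarrow> 0) (at t)" .
    show "\<forall>\<^sub>F s in at t.
        norm (ltrans (+) s (orbit_fun act M F) - ltrans (+) t (orbit_fun act M F))
          \<le> norm (K * norm (ltrans act s F - ltrans act t F))"
      using bound \<open>K \<ge> 0\<close> by (simp add: abs_mult)
  qed
  then show ?thesis by (simp add: LUC_def continuous_on_def)
qed

lemma apply_diamond:
  assumes "locally_compact_space (euclidean :: 'g::{topological_group_add,t2_space} topology)"
    and "n \<in> dual (LUC_group :: ('g \<Rightarrow>\<^sub>C complex) set)" and "f \<in> LUC_group"
  shows "apply_bcontfun (diamond n f) s = n (ltrans (+) s f)"
  using orbit_fun_in_bcontfun[OF G_space_translation[OF assms(1)] assms(2,3)]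
  by (simp add: diamond_def Bcontfun_inverse)

end

theory Submission
  imports Defs
begin

text \<open>
  The product \<open>\<odot>\<close> is the case \<open>act = (+)\<close> of the module action, so each axiom of the Banach
  algebra is a special case of an axiom of the module. Associativity reduces to the identity
  \<open>n \<diamond> (MF) = (n \<cdot> M)F\<close>, which holds because \<open>\<^sub>s(MF) = M(l\<^sub>s F)\<close>; the norm estimate comes from
  \<open>\<parallel>MF\<parallel> \<le> \<parallel>M\<parallel> \<parallel>F\<parallel>\<close>.
\<close>

section \<open>The dual norm\<close>

lemma norm_cscale_le: "norm (cscale c F) \<le> cmod c * norm F"
  by (rule norm_bound) (simp add: norm_mult mult_left_mono norm_bounded)

text \<open>Isolates what the Banach space structure of the dual rests on: \<open>L\<close> is a
  complex linear subspace. It is instantiated both with \<open>LUC_group\<close> and with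
  \<open>LUC act\<close>.\<close>

locale bcontfun_subspace =
  fixes L :: "('x::topological_space \<Rightarrow>\<^sub>C complex) set"
  assumes zero_mem: "0 \<in> L"
    and add_mem: "F \<in> L \<Longrightarrow> H \<in> L \<Longrightarrow> F + H \<in> L"
    and cscale_mem: "F \<in> L \<Longrightarrow> cscale c F \<in> L"
begin

lemma dual_add: "m \<in> dual L \<Longrightarrow> F \<in> L \<Longrightarrow> H \<in> L \<Longrightarrow> m (F + H) = m F + m H"
  by (simp add: dual_def)

lemma dual_cscale: "m \<in> dual L \<Longrightarrow> F \<in> L \<Longrightarrow> m (cscale c F) = c * m F"
  by (simp add: dual_def)

lemma dual_outside: "m \<in> dual L \<Longrightarrow> F \<notin> L \<Longrightarrow> m F = 0"
  by (simp add: dual_def)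

lemma dual_bounded: "m \<in> dual L \<Longrightarrow> \<exists>K. \<forall>F\<in>L. cmod (m F) \<le> K * norm F"
  by (simp add: dual_def)

text \<open>A real \<open>SUP\<close> carries information only over a set that is bounded above;
  this is the side condition for every upper estimate by \<open>dual_norm\<close>.\<close>

lemma bdd_above_dual_norm:
  assumes "m \<in> dual L"
  shows "bdd_above ((\<lambda>F. cmod (m F)) ` {F \<in> L. norm F \<le> 1})"
proof -
  obtain K where K: "cmod (m F) \<le> K * norm F" if "F \<in> L" for F
    using dual_bounded[OF assms] by blast
  have "cmod (m F) \<le> \<bar>K\<bar>" if "F \<in> L" "norm F \<le> 1" for F
  proof -
    have "cmod (m F) \<le> \<bar>K\<bar> * norm F"
      using K[OF that(1)] by (rule order_trans) (simp add: mult_right_mono)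
    also have "\<dots> \<le> \<bar>K\<bar> * 1" using that(2) by (intro mult_left_mono) auto
    finally show ?thesis by simp
  qed
  then show ?thesis by (intro bdd_aboveI2[where M = "\<bar>K\<bar>"]) auto
qed

lemma dual_norm_nonneg:
  assumes "m \<in> dual L"
  shows "0 \<le> dual_norm L m"
  unfolding dual_norm_def
  by (rule cSUP_upper2[OF bdd_above_dual_norm[OF assms], of 0]) (auto simp: zero_mem)

text \<open>Counterpart of \<open>le_dual_norm\<close>: for a functional in the dual, the two
  together make \<open>dual_norm\<close> the least nonnegative Lipschitz constant on
  \<open>L\<close>, so later norm estimates never return to the supremum.\<close>

lemma dual_norm_leI:
  assumes "0 \<le> K" and "\<And>F. F \<in> L \<Longrightarrow> cmod (m F) \<le> K * norm F"
  shows "dual_norm L m \<le> K"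
  unfolding dual_norm_def
proof (rule cSUP_least)
  show "{F \<in> L. norm F \<le> 1} \<noteq> {}" using zero_mem by auto
  fix F assume "F \<in> {F \<in> L. norm F \<le> 1}"
  then have "cmod (m F) \<le> K * norm F" "norm F \<le> 1" using assms(2) by auto
  then show "cmod (m F) \<le> K" using mult_left_mono[of "norm F" 1 K] assms(1) by simp
qed

lemma le_dual_norm:
  assumes m: "m \<in> dual L" and F: "F \<in> L"
  shows "cmod (m F) \<le> dual_norm L m * norm F"
proof (cases "F = 0")
  case True
  \<comment> \<open>Any bound \<open>K\<close> for \<open>m\<close> gives |m(0)| \<le> K * 0, hence
    m(0) = 0.\<close>
  then show ?thesis using dual_bounded[OF m] F by fastforce
next
  case False
  \<comment> \<open>Normalizing \<open>F\<close> puts it into the unit ball; homogeneity of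
    \<open>m\<close> then restores the factor \<open>norm F\<close>.\<close>
  let ?H = "cscale (of_real (inverse (norm F))) F"
  have "norm ?H \<le> 1"
    using norm_cscale_le[of "of_real (inverse (norm F))" F] False by (simp add: norm_inverse)
  then have "cmod (m ?H) \<le> dual_norm L m"
    unfolding dual_norm_def
    by (intro cSUP_upper bdd_above_dual_norm[OF m]) (simp add: cscale_mem F)
  then show ?thesis using False
    by (simp add: dual_cscale[OF m F] divide_inverse_commute[symmetric] norm_divide pos_divide_le_eq)
qed

section \<open>The dual as a normed vector space\<close>

lemma dualI:
  assumes "\<And>F H. F \<in> L \<Longrightarrow> H \<in> L \<Longrightarrow> m (F + H) = m F + m H"
    and "\<And>c F. F \<in> L \<Longrightarrow> m (cscale c F) = c * m F"
    and "\<And>F. F \<in> L \<Longrightarrow> cmod (m F) \<le> K * norm F"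
    and "\<And>F. F \<notin> L \<Longrightarrow> m F = 0"
  shows "m \<in> dual L"
  using assms unfolding dual_def by blast

text \<open>Extension by 0 outside \<open>L\<close> makes the representing function unique.\<close>

lemma dual_eqI:
  assumes "m \<in> dual L" and "n \<in> dual L" and "\<And>F. F \<in> L \<Longrightarrow> m F = n F"
  shows "m = n"
  using assms dual_outside by (metis ext)

lemma zero_in_dual: "0 \<in> dual L"
  by (rule dualI[where K = 0]) auto

lemma add_in_dual:
  assumes m: "m \<in> dual L" and n: "n \<in> dual L"
  shows "m + n \<in> dual L"
proof (rule dualI)
  fix F assume F: "F \<in> L"
  show "cmod ((m + n) F) \<le> (dual_norm L m + dual_norm L n) * norm F"
    using norm_triangle_ineq[of "m F" "n F"] le_dual_norm[OF m F] le_dual_norm[OF n F]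
    by (simp add: distrib_right)
qed (simp_all add: dual_add[OF m] dual_add[OF n] dual_cscale[OF m] dual_cscale[OF n]
    dual_outside[OF m] dual_outside[OF n] distrib_left)

lemma scale_in_dual:
  assumes m: "m \<in> dual L"
  shows "dual_scale c m \<in> dual L"
proof (rule dualI)
  fix F assume "F \<in> L"
  then show "cmod (dual_scale c m F) \<le> (cmod c * dual_norm L m) * norm F"
    using le_dual_norm[OF m] by (simp add: dual_scale_def norm_mult mult.assoc mult_left_mono)
qed (simp_all add: dual_scale_def dual_add[OF m] dual_cscale[OF m] dual_outside[OF m] distrib_left)

lemma diff_in_dual:
  assumes "m \<in> dual L" and "n \<in> dual L"
  shows "m - n \<in> dual L"
proof -
  have "m - n = m + dual_scale (-1) n" by (simp add: fun_eq_iff dual_scale_def)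
  then show ?thesis using add_in_dual[OF assms(1) scale_in_dual[OF assms(2)]] by metis
qed

lemma dual_norm_triangle:
  assumes m: "m \<in> dual L" and n: "n \<in> dual L"
  shows "dual_norm L (m + n) \<le> dual_norm L m + dual_norm L n"
proof (rule dual_norm_leI)
  fix F assume F: "F \<in> L"
  show "cmod ((m + n) F) \<le> (dual_norm L m + dual_norm L n) * norm F"
    using norm_triangle_ineq[of "m F" "n F"] le_dual_norm[OF m F] le_dual_norm[OF n F]
    by (simp add: distrib_right)
qed (simp add: dual_norm_nonneg m n)

lemma dual_norm_scale_le:
  assumes m: "m \<in> dual L"
  shows "dual_norm L (dual_scale c m) \<le> cmod c * dual_norm L m"
proof (rule dual_norm_leI)
  fix F assume "F \<in> L"
  then show "cmod (dual_scale c m F) \<le> (cmod c * dual_norm L m) * norm F"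
    using le_dual_norm[OF m] by (simp add: dual_scale_def norm_mult mult.assoc mult_left_mono)
qed (simp add: dual_norm_nonneg m)

text \<open>For nonzero \<open>c\<close> the reverse inequality is the one-sided bound
  \<open>dual_norm_scale_le\<close> applied to \<open>inverse c\<close>, which undoes the
  scaling.\<close>

lemma dual_norm_scale:
  assumes m: "m \<in> dual L"
  shows "dual_norm L (dual_scale c m) = cmod c * dual_norm L m"
proof (cases "c = 0")
  case True
  then show ?thesis
    using dual_norm_scale_le[OF m, of c] dual_norm_nonneg[OF scale_in_dual[OF m]]
    by (simp add: order_antisym)
next
  case False
  have "dual_scale (inverse c) (dual_scale c m) = m"
    using False by (simp add: dual_scale_def fun_eq_iff)
  then have "dual_norm L m \<le> inverse (cmod c) * dual_norm L (dual_scale c m)"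
    using dual_norm_scale_le[OF scale_in_dual[OF m], of "inverse c" c] by (simp add: norm_inverse)
  then show ?thesis
    using False dual_norm_scale_le[OF m, of c] by (intro order_antisym) (simp_all add: field_simps)
qed

lemma dual_norm_eq_0_iff:
  assumes m: "m \<in> dual L"
  shows "dual_norm L m = 0 \<longleftrightarrow> m = 0"
proof
  assume "dual_norm L m = 0"
  then show "m = 0"
    using le_dual_norm[OF m] by (intro dual_eqI[OF m zero_in_dual]) simp
next
  assume "m = 0"
  then have "dual_norm L m \<le> 0" by (intro dual_norm_leI) auto
  then show "dual_norm L m = 0" using dual_norm_nonneg[OF m] by simp
qed

text \<open>The limit is taken pointwise, by completeness of the complex numbers. The Cauchy
  estimate is uniform on the unit ball and survives the passage to the limit, which gives both
  boundedness of the limit and convergence in norm.\<close>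

lemma dual_complete:
  fixes u :: "nat \<Rightarrow> ('x \<Rightarrow>\<^sub>C complex) \<Rightarrow> complex"
  assumes u: "\<And>n. u n \<in> dual L"
    and Cauchy: "\<And>e. e > 0 \<Longrightarrow> \<exists>N. \<forall>i\<ge>N. \<forall>j\<ge>N. dual_norm L (u i - u j) < e"
  shows "\<exists>l\<in>dual L. (\<lambda>n. dual_norm L (u n - l)) \<longlonglongrightarrow> 0"
proof -
  have diff_le: "cmod (u i F - u j F) \<le> dual_norm L (u i - u j) * norm F" if "F \<in> L" for i j F
    using le_dual_norm[OF diff_in_dual[OF u u] that, of i j] by simp
  have "convergent (\<lambda>n. u n F)" for F
  proof (cases "F \<in> L")
    case False
    \<comment> \<open>Off \<open>L\<close> the sequence is constantly 0, so the limit inherits the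
      extension by 0.\<close>
    then show ?thesis using dual_outside[OF u] by (simp add: convergent_const)
  next
    case F: True
    show ?thesis
    proof (intro Cauchy_convergent CauchyI)
      fix e :: real assume "e > 0"
      \<comment> \<open>The summand 1 keeps the divisor positive when \<open>F\<close> is 0.\<close>
      have pos: "norm F + 1 > 0" by (simp add: add_nonneg_pos)
      with \<open>e > 0\<close> have "e / (norm F + 1) > 0" by simp
      then obtain N where N: "\<And>i j. i \<ge> N \<Longrightarrow> j \<ge> N \<Longrightarrow>
          dual_norm L (u i - u j) < e / (norm F + 1)"
        using Cauchy[of "e / (norm F + 1)"] by blast
      have "cmod (u i F - u j F) < e" if "i \<ge> N" "j \<ge> N" for i j
      proof -
        have "cmod (u i F - u j F) \<le> dual_norm L (u i - u j) * (norm F + 1)"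
          using diff_le[OF F, of i j] dual_norm_nonneg[OF diff_in_dual[OF u u], of i j]
          by (simp add: distrib_left)
        also have "\<dots> < e" using N[OF that] pos by (simp add: pos_less_divide_eq)
        finally show ?thesis .
      qed
      then show "\<exists>N. \<forall>i\<ge>N. \<forall>j\<ge>N. norm (u i F - u j F) < e" by blast
    qed
  qed
  then obtain l where l: "\<And>F. (\<lambda>n. u n F) \<longlonglongrightarrow> l F"
    unfolding convergent_def by metis
  \<comment> \<open>Fix \<open>i\<close> and let \<open>j\<close> tend to infinity in the Cauchy
    estimate; \<open>N\<close> depends on \<open>e\<close> alone and not on
    \<open>F\<close>.\<close>
  have tail: "\<exists>N. \<forall>i\<ge>N. \<forall>F\<in>L. cmod (u i F - l F) \<le> e * norm F" if "e > 0" for e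
  proof -
    obtain N where N: "\<And>i j. i \<ge> N \<Longrightarrow> j \<ge> N \<Longrightarrow> dual_norm L (u i - u j) < e"
      using Cauchy[of e] \<open>e > 0\<close> by blast
    have "cmod (u i F - l F) \<le> e * norm F" if "i \<ge> N" "F \<in> L" for i F
    proof (rule Lim_bounded)
      show "(\<lambda>j. cmod (u i F - u j F)) \<longlonglongrightarrow> cmod (u i F - l F)"
        by (intro tendsto_intros l)
      show "\<forall>j\<ge>N. cmod (u i F - u j F) \<le> e * norm F"
        using diff_le[OF that(2), of i] N[OF that(1)]
        by (meson less_imp_le mult_right_mono norm_ge_zero order_trans)
    qed
    then show ?thesis by blast
  qed
  have l_dual: "l \<in> dual L"
  proof -
    \<comment> \<open>One index suffices: \<open>l\<close> differs from the bounded functional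
      \<open>u N\<close> by at most \<open>norm F\<close>, hence the bound
      \<open>dual_norm L (u N) + 1\<close>.\<close>
    obtain N where N: "cmod (u N F - l F) \<le> 1 * norm F" if "F \<in> L" for F
      using tail[of 1] by auto
    show ?thesis
    proof (rule dualI)
      fix F H assume "F \<in> L" "H \<in> L"
      then have "(\<lambda>n. u n (F + H)) \<longlonglongrightarrow> l F + l H"
        using tendsto_add[OF l l] by (simp add: dual_add[OF u])
      then show "l (F + H) = l F + l H" using l LIMSEQ_unique by blast
    next
      fix c F assume "F \<in> L"
      then have "(\<lambda>n. u n (cscale c F)) \<longlonglongrightarrow> c * l F"
        using tendsto_mult_left[OF l] by (simp add: dual_cscale[OF u])
      then show "l (cscale c F) = c * l F" using l LIMSEQ_unique by blast
    next
      fix F assume F: "F \<in> L"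
      have "cmod (l F) \<le> cmod (u N F) + cmod (u N F - l F)"
        by (metis norm_minus_commute norm_triangle_sub)
      then show "cmod (l F) \<le> (dual_norm L (u N) + 1) * norm F"
        using N[OF F] le_dual_norm[OF u F, of N] by (simp add: distrib_right)
    next
      fix F assume "F \<notin> L"
      then have "(\<lambda>n. u n F) \<longlonglongrightarrow> 0" by (simp add: dual_outside[OF u])
      then show "l F = 0" using l LIMSEQ_unique by blast
    qed
  qed
  have "(\<lambda>n. dual_norm L (u n - l)) \<longlonglongrightarrow> 0"
  proof (rule LIMSEQ_I)
    fix e :: real assume "e > 0"
    \<comment> \<open>Halving \<open>e\<close> compensates for the supremum turning the estimates
      into a non-strict one.\<close>
    then obtain N where N: "\<forall>i\<ge>N. \<forall>F\<in>L. cmod (u i F - l F) \<le> e / 2 * norm F"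
      using tail[of "e / 2"] by auto
    have "dual_norm L (u i - l) \<le> e / 2" if "i \<ge> N" for i
      using N that \<open>e > 0\<close> by (intro dual_norm_leI) auto
    then have "norm (dual_norm L (u i - l) - 0) < e" if "i \<ge> N" for i
      using that \<open>e > 0\<close> dual_norm_nonneg[OF diff_in_dual[OF u l_dual], of i] by fastforce
    then show "\<exists>N. \<forall>i\<ge>N. norm (dual_norm L (u i - l) - 0) < e" by blast
  qed
  with l_dual show ?thesis by blast
qed

lemma dual_banach_space: "complex_banach_space dual_scale (dual L) (dual_norm L)"
proof -
  \<comment> \<open>The ambient vector space consists of all complex functions on the bounded
    continuous functions; the dual is a subspace of it.\<close>
  interpret vector_space "dual_scale :: complex \<Rightarrow> (('x \<Rightarrow>\<^sub>C complex) \<Rightarrow> complex) \<Rightarrow> _"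
    by unfold_locales (simp_all add: dual_scale_def fun_eq_iff algebra_simps)
  show ?thesis
  proof
    show "subspace (dual L)"
      by (simp add: subspace_def zero_in_dual add_in_dual scale_in_dual)
  qed (simp_all add: dual_norm_nonneg dual_norm_eq_0_iff dual_norm_scale dual_norm_triangle
      dual_complete)
qed

end

section \<open>The module action\<close>

text \<open>Each l_s is complex linear, so the orbit map of a linear combination is the same
  combination of continuous orbit maps.\<close>

lemma bcontfun_subspace_LUC:
  assumes "G_space act"
  shows "bcontfun_subspace (LUC act)"
proof
  have "ltrans act s 0 = 0" for s
    by (intro bcontfun_eqI) (simp add: apply_ltrans[OF assms])
  then show "0 \<in> LUC act" by (simp add: LUC_def)
next
  fix F H assume "F \<in> LUC act" "H \<in> LUC act"
  moreover have "ltrans act s (F + H) = ltrans act s F + ltrans act s H" for s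
    by (intro bcontfun_eqI) (simp add: apply_ltrans[OF assms])
  ultimately show "F + H \<in> LUC act" by (auto simp: LUC_def intro!: continuous_intros)
next
  fix F c assume F: "F \<in> LUC act"
  have ltrans_cscale: "ltrans act s (cscale c F) = cscale c (ltrans act s F)" for s
    by (intro bcontfun_eqI) (simp add: apply_ltrans[OF assms])
  \<comment> \<open>Makes multiplication by \<open>c\<close> Lipschitz in the supremum norm, so
    composing it with the orbit map of \<open>F\<close> keeps continuity.\<close>
  have bound: "norm (cscale c A - cscale c B) \<le> cmod c * norm (A - B)"
    for A B :: "'b \<Rightarrow>\<^sub>C complex"
  proof (rule norm_bound)
    fix x
    have "norm ((cscale c A - cscale c B) x) = cmod c * norm ((A - B) x)"
      by (simp add: norm_mult[symmetric] algebra_simps)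
    then show "norm ((cscale c A - cscale c B) x) \<le> cmod c * norm (A - B)"
      by (simp add: mult_left_mono norm_bounded del: minus_bcontfun.rep_eq)
  qed
  have "continuous_on UNIV (cscale c :: ('b \<Rightarrow>\<^sub>C complex) \<Rightarrow> _)"
    by (intro lipschitz_on_continuous_on[of "cmod c"] lipschitz_onI) (simp_all add: dist_norm bound)
  then have "continuous_on UNIV (cscale c \<circ> (\<lambda>s. ltrans act s F))"
    using F by (intro continuous_on_compose) (auto simp: LUC_def intro: continuous_on_subset)
  then show "cscale c F \<in> LUC act" by (simp add: LUC_def ltrans_cscale o_def)
qed

lemma LUC_smul_add_left: "LUC_smul act (m + n) M = LUC_smul act m M + LUC_smul act n M"
  by (simp add: LUC_smul_def fun_eq_iff)

lemma LUC_smul_scale_left: "LUC_smul act (dual_scale k m) M = dual_scale k (LUC_smul act m M)"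
  by (simp add: LUC_smul_def dual_scale_def fun_eq_iff)

text \<open>Local compactness of the group makes it a G-space under its own translation. The dual
  theory is thus available twice, with prefix \<open>G\<close> for LUC(G) and prefix
  \<open>X\<close> for LUC(X,G).\<close>

locale lc_G_space =
  fixes act :: "'g::{topological_group_add,t2_space} \<Rightarrow> 'x::t2_space \<Rightarrow> 'x"
  assumes lc: "locally_compact_space (euclidean :: 'g topology)"
    and G_space: "G_space act"
begin

sublocale G: bcontfun_subspace "LUC_group :: ('g \<Rightarrow>\<^sub>C complex) set"
  by (rule bcontfun_subspace_LUC[OF G_space_translation[OF lc]])

sublocale X: bcontfun_subspace "LUC act"
  by (rule bcontfun_subspace_LUC[OF G_space])

section \<open>Bilinearity of \<open>MF\<close> in \<open>M\<close> and \<open>F\<close>\<close>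

lemmas apply_orbit = apply_orbit_fun[OF G_space]
lemmas orbit_mem = orbit_fun_in_LUC_group[OF lc G_space]
lemmas ltrans_mem = ltrans_in_LUC[OF G_space]

lemma orbit_fun_add:
  assumes "M \<in> dual (LUC act)" and "F \<in> LUC act" and "H \<in> LUC act"
  shows "orbit_fun act M (F + H) = orbit_fun act M F + orbit_fun act M H"
proof (rule bcontfun_eqI)
  fix s
  have "ltrans act s (F + H) = ltrans act s F + ltrans act s H"
    by (intro bcontfun_eqI) (simp add: apply_ltrans[OF G_space])
  then show "orbit_fun act M (F + H) s = (orbit_fun act M F + orbit_fun act M H) s"
    using assms by (simp add: apply_orbit X.add_mem X.dual_add ltrans_mem)
qed

lemma orbit_fun_cscale:
  assumes "M \<in> dual (LUC act)" and "F \<in> LUC act"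
  shows "orbit_fun act M (cscale c F) = cscale c (orbit_fun act M F)"
proof (rule bcontfun_eqI)
  fix s
  have "ltrans act s (cscale c F) = cscale c (ltrans act s F)"
    by (intro bcontfun_eqI) (simp add: apply_ltrans[OF G_space])
  then show "orbit_fun act M (cscale c F) s = cscale c (orbit_fun act M F) s"
    using assms by (simp add: apply_orbit X.cscale_mem X.dual_cscale ltrans_mem)
qed

lemma orbit_fun_add_functional:
  assumes "M \<in> dual (LUC act)" and "N \<in> dual (LUC act)" and "F \<in> LUC act"
  shows "orbit_fun act (M + N) F = orbit_fun act M F + orbit_fun act N F"
  using assms by (intro bcontfun_eqI) (simp add: apply_orbit X.add_in_dual)

lemma orbit_fun_scale_functional:
  assumes "M \<in> dual (LUC act)" and "F \<in> LUC act"
  shows "orbit_fun act (dual_scale c M) F = cscale c (orbit_fun act M F)"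
proof (rule bcontfun_eqI)
  fix s
  show "orbit_fun act (dual_scale c M) F s = cscale c (orbit_fun act M F) s"
    \<comment> \<open>Evaluation comes before \<open>dual_scale\<close> is unfolded, because
      membership in the dual is stated for the folded form.\<close>
    unfolding apply_orbit[OF X.scale_in_dual[OF assms(1)] assms(2)]
    by (simp add: dual_scale_def apply_orbit[OF assms])
qed

section \<open>Norm estimates and boundedness of the action\<close>

lemma norm_orbit_fun_le:
  assumes M: "M \<in> dual (LUC act)" and F: "F \<in> LUC act"
  shows "norm (orbit_fun act M F) \<le> dual_norm (LUC act) M * norm F"
proof (rule norm_bound)
  fix s
  have "cmod (M (ltrans act s F)) \<le> dual_norm (LUC act) M * norm (ltrans act s F)"
    by (rule X.le_dual_norm[OF M ltrans_mem[OF F]])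
  \<comment> \<open>l_s does not increase the supremum norm, so the bound is uniform in
    \<open>s\<close>.\<close>
  also have "\<dots> \<le> dual_norm (LUC act) M * norm F"
    by (intro mult_left_mono norm_ltrans_le[OF G_space] X.dual_norm_nonneg[OF M])
  finally show "norm (orbit_fun act M F s) \<le> dual_norm (LUC act) M * norm F"
    by (simp add: apply_orbit[OF M F])
qed

text \<open>Kept pointwise in \<open>F\<close> because it serves twice: as the boundedness required
  by \<open>LUC_smul_in_dual\<close>, and through \<open>dual_norm_leI\<close> as the norm
  inequality.\<close>

lemma norm_LUC_smul_apply_le:
  assumes m: "m \<in> dual LUC_group" and M: "M \<in> dual (LUC act)" and F: "F \<in> LUC act"
  shows "cmod (LUC_smul act m M F) \<le> dual_norm LUC_group m * dual_norm (LUC act) M * norm F"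
proof -
  have "cmod (m (orbit_fun act M F)) \<le> dual_norm LUC_group m * norm (orbit_fun act M F)"
    by (rule G.le_dual_norm[OF m orbit_mem[OF M F]])
  also have "\<dots> \<le> dual_norm LUC_group m * (dual_norm (LUC act) M * norm F)"
    by (intro mult_left_mono norm_orbit_fun_le[OF M F] G.dual_norm_nonneg[OF m])
  finally show ?thesis by (simp add: LUC_smul_def F)
qed

lemma LUC_smul_in_dual:
  assumes m: "m \<in> dual LUC_group" and M: "M \<in> dual (LUC act)"
  shows "LUC_smul act m M \<in> dual (LUC act)"
proof (rule X.dualI)
  show "cmod (LUC_smul act m M F) \<le> dual_norm LUC_group m * dual_norm (LUC act) M * norm F"
    if "F \<in> LUC act" for F
    by (rule norm_LUC_smul_apply_le[OF m M that])
qed (simp_all add: LUC_smul_def X.add_mem X.cscale_mem orbit_fun_add[OF M] orbit_fun_cscale[OF M]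
    G.dual_add[OF m] G.dual_cscale[OF m] orbit_mem[OF M])

lemma dual_norm_LUC_smul_le:
  assumes m: "m \<in> dual LUC_group" and M: "M \<in> dual (LUC act)"
  shows "dual_norm (LUC act) (LUC_smul act m M) \<le> dual_norm LUC_group m * dual_norm (LUC act) M"
  by (rule X.dual_norm_leI)
    (simp_all add: norm_LUC_smul_apply_le[OF m M] G.dual_norm_nonneg[OF m] X.dual_norm_nonneg[OF M])

section \<open>Associativity of the action\<close>

lemma ltrans_orbit_fun:
  assumes M: "M \<in> dual (LUC act)" and F: "F \<in> LUC act"
  shows "ltrans (+) s (orbit_fun act M F) = orbit_fun act M (ltrans act s F)"
  by (rule bcontfun_eqI)
    (simp add: apply_ltrans[OF G_space_translation[OF lc]] apply_orbit[OF M] F ltrans_mem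
      ltrans_ltrans[OF G_space])

text \<open>At \<open>s\<close> both sides are n(M(l_s F)): translating \<open>MF\<close> by
  \<open>s\<close> amounts to replacing \<open>F\<close> by l_s F, and pairing with \<open>n\<close>
  gives the value of n.M at l_s F.\<close>

lemma diamond_orbit_fun:
  assumes n: "n \<in> dual LUC_group" and M: "M \<in> dual (LUC act)" and F: "F \<in> LUC act"
  shows "diamond n (orbit_fun act M F) = orbit_fun act (LUC_smul act n M) F"
proof (rule bcontfun_eqI)
  fix s
  show "diamond n (orbit_fun act M F) s = orbit_fun act (LUC_smul act n M) F s"
    unfolding apply_diamond[OF lc n orbit_mem[OF M F]] apply_orbit[OF LUC_smul_in_dual[OF n M] F]
    by (simp add: LUC_smul_def ltrans_mem[OF F] ltrans_orbit_fun[OF M F])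
qed

lemma LUC_smul_assoc:
  assumes "m \<in> dual LUC_group" and n: "n \<in> dual LUC_group" and M: "M \<in> dual (LUC act)"
  shows "LUC_smul act (LUC_mult m n) M = LUC_smul act m (LUC_smul act n M)"
proof (rule ext)
  fix F
  show "LUC_smul act (LUC_mult m n) M F = LUC_smul act m (LUC_smul act n M) F"
  proof (cases "F \<in> LUC act")
    case True
    then show ?thesis
      \<comment> \<open>Only the outer actions are unfolded; \<open>LUC_smul act n M\<close> stays
        intact so that \<open>diamond_orbit_fun\<close> can produce it on the other side.\<close>
      unfolding LUC_smul_def[of act "LUC_mult m n"] LUC_smul_def[of act m]
      by (simp add: LUC_mult_def orbit_mem[OF M] diamond_orbit_fun[OF n M])
  qed (simp add: LUC_smul_def)
qed

lemma LUC_smul_add_right: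
  assumes m: "m \<in> dual LUC_group" and M: "M \<in> dual (LUC act)" and N: "N \<in> dual (LUC act)"
  shows "LUC_smul act m (M + N) = LUC_smul act m M + LUC_smul act m N"
  by (simp add: LUC_smul_def fun_eq_iff orbit_fun_add_functional[OF M N] G.dual_add[OF m]
      orbit_mem[OF M] orbit_mem[OF N])

lemma LUC_smul_scale_right:
  assumes m: "m \<in> dual LUC_group" and M: "M \<in> dual (LUC act)"
  shows "LUC_smul act m (dual_scale k M) = dual_scale k (LUC_smul act m M)"
proof (rule ext)
  fix F
  show "LUC_smul act m (dual_scale k M) F = dual_scale k (LUC_smul act m M) F"
    using orbit_fun_scale_functional[OF M, of F k] G.dual_cscale[OF m orbit_mem[OF M], of F k]
    by (simp add: LUC_smul_def dual_scale_def)
qed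

section \<open>The point evaluation at the identity\<close>

lemma delta_e_in_dual: "(delta_e :: ('g \<Rightarrow>\<^sub>C complex) \<Rightarrow> complex) \<in> dual LUC_group"
  by (rule G.dualI[where K = 1])
    (simp_all add: delta_e_def G.add_mem G.cscale_mem norm_bounded)

text \<open>Evaluating \<open>MF\<close> at the identity gives M(l_e F), and l_e is the identity map
  because e acts trivially.\<close>

lemma LUC_smul_delta_e:
  assumes M: "M \<in> dual (LUC act)"
  shows "LUC_smul act delta_e M = M"
proof (rule X.dual_eqI[OF LUC_smul_in_dual[OF delta_e_in_dual M] M])
  fix F assume F: "F \<in> LUC act"
  have "ltrans act 0 F = F"
    using G_space by (intro bcontfun_eqI) (simp add: apply_ltrans G_space_def)
  then show "LUC_smul act delta_e M F = M F"
    by (simp add: LUC_smul_def F delta_e_def orbit_mem[OF M F] apply_orbit[OF M F])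
qed

end

section \<open>The Banach algebra as a special case, and the assembled module\<close>

lemma LUC_mult_eq_LUC_smul: "LUC_mult = LUC_smul (+)"
  by (simp add: fun_eq_iff LUC_mult_def LUC_smul_def diamond_def orbit_fun_def)

lemma LUC_dual_banach_algebra:
  assumes "locally_compact_space (euclidean :: 'g::{topological_group_add,t2_space} topology)"
  shows "complex_banach_algebra dual_scale (dual (LUC_group :: ('g \<Rightarrow>\<^sub>C complex) set))
           (dual_norm LUC_group) LUC_mult"
proof -
  \<comment> \<open>With the group acting on itself, the spaces of the prefixes \<open>G\<close> and
    \<open>X\<close> coincide.\<close>
  interpret lc_G_space "(+) :: 'g \<Rightarrow> 'g \<Rightarrow> 'g"
    by unfold_locales (rule assms G_space_translation[OF assms])+
  interpret complex_banach_space dual_scale "dual (LUC_group :: ('g \<Rightarrow>\<^sub>C complex) set)"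
    "dual_norm LUC_group"
    by (rule G.dual_banach_space)
  \<comment> \<open>\<open>LUC_smul_assoc\<close> mixes product and action; rewriting the product as
    the action turns it into associativity of the product.\<close>
  show ?thesis
    by unfold_locales
      (simp_all only: LUC_mult_eq_LUC_smul LUC_smul_in_dual
        LUC_smul_assoc[unfolded LUC_mult_eq_LUC_smul] LUC_smul_add_left LUC_smul_add_right
        LUC_smul_scale_left LUC_smul_scale_right dual_norm_LUC_smul_le)
qed

theorem proposition3p4:
  fixes act :: "'g::{topological_group_add,t2_space} \<Rightarrow> 'x::t2_space \<Rightarrow> 'x"
  assumes "locally_compact_space (euclidean :: 'g topology)"
    and "G_space act"
  shows "banach_left_module
           dual_scale (dual (LUC_group :: ('g \<Rightarrow>\<^sub>C complex) set)) (dual_norm LUC_group) LUC_mult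
           dual_scale (dual (LUC act)) (dual_norm (LUC act)) (LUC_smul act)
       \<and> (\<forall>m\<in>dual (LUC_group :: ('g \<Rightarrow>\<^sub>C complex) set). \<forall>M\<in>dual (LUC act).
            dual_norm (LUC act) (LUC_smul act m M)
              \<le> dual_norm LUC_group m * dual_norm (LUC act) M)
       \<and> (delta_e :: ('g \<Rightarrow>\<^sub>C complex) \<Rightarrow> complex) \<in> dual LUC_group
       \<and> (\<forall>M\<in>dual (LUC act). LUC_smul act delta_e M = M)"
proof -
  interpret lc_G_space act by unfold_locales (rule assms)+
  interpret A: complex_banach_algebra dual_scale "dual (LUC_group :: ('g \<Rightarrow>\<^sub>C complex) set)"
    "dual_norm LUC_group" LUC_mult
    by (rule LUC_dual_banach_algebra[OF assms(1)])
  interpret E: complex_banach_space dual_scale "dual (LUC act)" "dual_norm (LUC act)"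
    by (rule X.dual_banach_space)
  have "banach_left_module
      dual_scale (dual (LUC_group :: ('g \<Rightarrow>\<^sub>C complex) set)) (dual_norm LUC_group) LUC_mult
      dual_scale (dual (LUC act)) (dual_norm (LUC act)) (LUC_smul act)"
  proof
    show "\<exists>K. \<forall>m\<in>dual LUC_group. \<forall>M\<in>dual (LUC act). dual_norm (LUC act) (LUC_smul act m M)
        \<le> K * dual_norm LUC_group m * dual_norm (LUC act) M"
      \<comment> \<open>The action is contractive, so the module constant may be 1.\<close>
      using dual_norm_LUC_smul_le by (intro exI[of _ 1]) simp
  qed (simp_all only: LUC_smul_in_dual LUC_smul_assoc LUC_smul_add_left LUC_smul_add_right
      LUC_smul_scale_left LUC_smul_scale_right)
  then show ?thesis
    using dual_norm_LUC_smul_le delta_e_in_dual LUC_smul_delta_e by blast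
qed

end
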